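(* Let $G^\sigma$ be an oriented hypergraph whose underlying hypergraph $G$ is connected and $k$-uniform with $k$ even. Then the signed hypergraph $\Gamma G^\sigma$ is switching equivalent to $\Gamma G^+$ if and only if $-\rho(\mathcal{A}(G))$ is an H-eigenvalue of $\mathcal{A}(\Gamma G^\sigma)$.
   Context: A $k$-uniform hypergraph $G$ has vertex set $[n]$ and edge set $E(G)$ of $k$-element subsets; it is connected if any two elements of $V(G)\cup E(G)$ are joined by an alternating vertex–edge sequence with consecutive elements incident. An oriented hypergraph $G^\sigma$ is $G$ with a map $\sigma$ assigning $\pm1$ to each pair $(e,v)$ with $v\in e$; $G^+$ has $\sigma\equiv1$. The induced signed hypergraph $\Gamma G^\sigma$ is $G$ with edge signs $\gamma(e)=(-1)^{|e|-1}\prod_{v\in e}\sigma(e,v)$. A vertex switching at $v$ on a signed hypergraph negates the sign of every edge containing $v$; switching equivalence means related by a finite sequence of vertex switchings. The adjacency tensor $\mathcal{A}(\Gamma)$ of a signed hypergraph $(G,\gamma)$ is the order-$k$, dimension-$n$ tensor with entry $\gamma(e)/(k-1)!$ at $(i_1,\dots,i_k)$ if $\{i_1,\dots,i_k\}=e\in E(G)$ and $0$ otherwise; $\mathcal{A}(G)$ is the same with all $\gamma(e)=1$. For an order-$k$ dimension-$n$ tensor $\mathcal{A}$ and $x\in\mathbb{C}^n$, $(\mathcal{A}x^{k-1})_i=\sum_{i_2,\dots,i_k}a_{ii_2\dots i_k}x_{i_2}\cdots x_{i_k}$; $\lambda\in\mathbb{C}$ is an eigenvalue if $\mathcal{A}x^{k-1}=\lambda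 x^{[k-1]}$ for some nonzero $x\in\mathbb{C}^n$, where $x^{[k-1]}=(x_1^{k-1},\dots,x_n^{k-1})$; it is an H-eigenvalue if such an $x$ can be chosen real. $\rho(\mathcal{A})$ is the maximum modulus of the eigenvalues of $\mathcal{A}$. *)

theory Defs
  imports "HOL-Analysis.Analysis"
begin

text \<open>
  The vertex set \<open>[n]\<close> is a finite type \<open>'n\<close> with \<open>n = CARD('n)\<close>; a hypergraph is given by
  its edge set. Sign functions and orientations are total functions of which only the values on
  the edges, respectively on the incident edge-vertex pairs, matter.
\<close>

definition uniform_hypergraph :: "nat \<Rightarrow> 'n::finite set set \<Rightarrow> bool" where
  "uniform_hypergraph k E \<longleftrightarrow> (\<forall>e\<in>E. card e = k)"

text \<open>
  Incidence on the disjoint union of vertices and edges relates only vertices to edges, so a list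
  with consecutive elements incident is automatically alternating.
\<close>

fun incident :: "'n + 'n set \<Rightarrow> 'n + 'n set \<Rightarrow> bool" where
  "incident (Inl v) (Inr e) \<longleftrightarrow> v \<in> e"
| "incident (Inr e) (Inl v) \<longleftrightarrow> v \<in> e"
| "incident (Inl v) (Inl w) \<longleftrightarrow> False"
| "incident (Inr e) (Inr f) \<longleftrightarrow> False"

definition hypergraph_walk :: "'n set set \<Rightarrow> ('n + 'n set) list \<Rightarrow> bool" where
  "hypergraph_walk E w \<longleftrightarrow> w \<noteq> [] \<and> set w \<subseteq> UNIV <+> E \<and> successively incident w"

definition connected_hypergraph :: "'n::finite set set \<Rightarrow> bool" where
  "connected_hypergraph E \<longleftrightarrow>
     (\<forall>a \<in> UNIV <+> E. \<forall>b \<in> UNIV <+> E. \<exists>w. hypergraph_walk E w \<and> hd w = a \<and> last w = b)"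

definition is_orientation :: "'n::finite set set \<Rightarrow> ('n set \<Rightarrow> 'n \<Rightarrow> int) \<Rightarrow> bool" where
  "is_orientation E \<sigma> \<longleftrightarrow> (\<forall>e\<in>E. \<forall>v\<in>e. \<sigma> e v \<in> {1, -1})"

definition positive_orientation :: "'n::finite set \<Rightarrow> 'n \<Rightarrow> int" where
  "positive_orientation = (\<lambda>e v. 1)"

definition induced_sign :: "('n::finite set \<Rightarrow> 'n \<Rightarrow> int) \<Rightarrow> 'n set \<Rightarrow> int" where
  "induced_sign \<sigma> e = (-1) ^ (card e - 1) * (\<Prod>v\<in>e. \<sigma> e v)"

definition vertex_switch :: "'n \<Rightarrow> ('n set \<Rightarrow> int) \<Rightarrow> 'n set \<Rightarrow> int" where
  "vertex_switch v \<gamma> = (\<lambda>e. if v \<in> e then - \<gamma> e else \<gamma> e)"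

text \<open>Two signed hypergraphs on the same edge set are equal if their signs agree on all edges.\<close>

definition switching_equivalent ::
    "'n::finite set set \<Rightarrow> ('n set \<Rightarrow> int) \<Rightarrow> ('n set \<Rightarrow> int) \<Rightarrow> bool" where
  "switching_equivalent E \<gamma> \<gamma>' \<longleftrightarrow> (\<exists>vs. \<forall>e\<in>E. fold vertex_switch vs \<gamma> e = \<gamma>' e)"

text \<open>
  A tensor of order \<open>k\<close> and dimension \<open>n\<close> is a function on index lists of length \<open>k\<close>.
\<close>

type_synonym 'n tensor = "'n list \<Rightarrow> complex"

definition adjacency_tensor ::
    "nat \<Rightarrow> 'n::finite set set \<Rightarrow> ('n set \<Rightarrow> int) \<Rightarrow> 'n tensor" where
  "adjacency_tensor k E \<gamma> js =
     (if length js = k \<and> set js \<in> E then of_int (\<gamma> (set js)) / fact (k - 1) else 0)"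

definition tensor_apply :: "nat \<Rightarrow> 'n::finite tensor \<Rightarrow> complex ^ 'n \<Rightarrow> complex ^ 'n" where
  "tensor_apply k A x = (\<chi> i. \<Sum>js | length js = k - 1. A (i # js) * (\<Prod>j\<leftarrow>js. x $ j))"

definition is_eigenpair :: "nat \<Rightarrow> 'n::finite tensor \<Rightarrow> complex \<Rightarrow> complex ^ 'n \<Rightarrow> bool" where
  "is_eigenpair k A l x \<longleftrightarrow> x \<noteq> 0 \<and> tensor_apply k A x = (\<chi> i. l * (x $ i) ^ (k - 1))"

definition tensor_eigenvalue :: "nat \<Rightarrow> 'n::finite tensor \<Rightarrow> complex \<Rightarrow> bool" where
  "tensor_eigenvalue k A l \<longleftrightarrow> (\<exists>x. is_eigenpair k A l x)"

definition H_eigenvalue :: "nat \<Rightarrow> 'n::finite tensor \<Rightarrow> complex \<Rightarrow> bool" where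
  "H_eigenvalue k A l \<longleftrightarrow> (\<exists>x. (\<forall>i. x $ i \<in> \<real>) \<and> is_eigenpair k A l x)"

definition tensor_spectral_radius :: "nat \<Rightarrow> 'n::finite tensor \<Rightarrow> real" where
  "tensor_spectral_radius k A = (GREATEST r. \<exists>l. tensor_eigenvalue k A l \<and> r = cmod l)"

end

theory Submission
  imports Defs "HOL-Combinatorics.Multiset_Permutations"
begin

text \<open>
  For real \<open>x\<close> put \<open>F x = (\<Sum>e\<in>E. \<Prod>v\<in>e. x v)\<close> and \<open>N x = (\<Sum>i. x i ^ k)\<close>. As \<open>k\<close> is even,
  \<open>{N = 1}\<close> is compact and \<open>F x \<le> F \<bar>x\<bar>\<close>, so \<open>k * F / N\<close> attains its maximum \<open>M\<close> at some
  \<open>z \<ge> 0\<close>, which is a critical point without any boundary condition, i.e. an eigenvector for \<open>M\<close>.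
  Contracting an eigenvalue equation with its eigenvector bounds the modulus of every eigenvalue by
  \<open>M\<close>, so \<open>M\<close> is the spectral radius. Connectedness makes every nonnegative maximiser positive:
  raising the zero coordinates to \<open>\<epsilon>\<close> gains at least order \<open>\<epsilon> ^ (k - 1)\<close> in \<open>F\<close> but costs only
  order \<open>\<epsilon> ^ k\<close> in \<open>N\<close>.

  A real eigenvector \<open>x\<close> of the signed hypergraph for \<open>-M\<close> forces equality in
  \<open>\<bar>\<Sum>e\<in>E. \<gamma> e * (\<Prod>v\<in>e. x v)\<bar> \<le> F \<bar>x\<bar> \<le> M * N x / k\<close>, hence \<open>\<bar>x\<bar>\<close> is positive and
  \<open>\<gamma> e * (\<Prod>v\<in>e. sgn (x v)) = -1\<close> on every edge. Conversely such signs turn \<open>z\<close> into an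
  eigenvector for \<open>-M\<close>.
\<close>

section \<open>Connectedness through invariants of walks\<close>

lemma hypergraph_walk_invariant:
  assumes "hypergraph_walk E w" "P (hd w)"
    and "\<And>a b. a \<in> UNIV <+> E \<Longrightarrow> b \<in> UNIV <+> E \<Longrightarrow> incident a b \<Longrightarrow> P a \<Longrightarrow> P b"
  shows "P (last w)"
proof -
  have "w \<noteq> []" "set w \<subseteq> UNIV <+> E" "successively incident w"
    using assms(1) by (auto simp: hypergraph_walk_def)
  then show ?thesis
    using assms(2)
  proof (induction w rule: induct_list012)
    case (3 a b w)
    then have "P b" using assms(3)[of a b] by auto
    with 3 show ?case by auto
  qed auto
qed

text \<open>If every edge meeting \<open>S\<close> lay inside \<open>S\<close>, then lying in
  \<open>S\<close>, for vertices, and being contained in \<open>S\<close>, for edges, would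
  propagate along incidences, and no walk from \<open>a\<close> could reach
  \<open>b\<close>.\<close>

lemma connected_hypergraph_crossing_edge:
  assumes "connected_hypergraph E" "a \<in> S" "b \<notin> S"
  shows "\<exists>e\<in>E. e \<inter> S \<noteq> {} \<and> e - S \<noteq> {}"
proof (rule ccontr)
  assume *: "\<not> ?thesis"
  obtain w where w: "hypergraph_walk E w" "hd w = Inl a" "last w = Inl b"
    using assms(1) unfolding connected_hypergraph_def by (metis InlI UNIV_I)
  let ?P = "case_sum (\<lambda>v. v \<in> S) (\<lambda>e. e \<subseteq> S)"
  have "?P (last w)"
  proof (rule hypergraph_walk_invariant[OF w(1)])
    fix c d assume "c \<in> UNIV <+> E" "d \<in> UNIV <+> E" "incident c d" "?P c"
    with * show "?P d" by (cases c; cases d) auto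
  qed (use w assms in auto)
  with w assms show False by simp
qed

text \<open>The empty edge is incident with no vertex, so a walk starting at a vertex never arrives
  there. This is what excludes \<open>k = 0\<close> once there is an edge.\<close>

lemma connected_hypergraph_edge_nonempty:
  assumes "connected_hypergraph E" "e \<in> E"
  shows "e \<noteq> {}"
proof
  assume "e = {}"
  obtain w where w: "hypergraph_walk E w" "hd w = Inl undefined" "last w = Inr e"
    using assms unfolding connected_hypergraph_def by (metis InlI InrI UNIV_I)
  let ?P = "case_sum (\<lambda>_. True) (\<lambda>e. e \<noteq> {})"
  have "?P (last w)"
  proof (rule hypergraph_walk_invariant[OF w(1)])
    fix c d assume "incident c d" "?P c"
    then show "?P d" by (cases c; cases d) auto
  qed (use w in auto)
  with w \<open>e = {}\<close> show False by simp
qed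

section \<open>Switching as multiplication by vertex signs\<close>

lemma fold_vertex_switch:
  fixes e :: "'n::finite set"
  shows "fold vertex_switch vs \<gamma> e = (\<Prod>v\<in>e. (-1) ^ count_list vs v) * \<gamma> e"
proof (induction vs arbitrary: \<gamma>)
  case (Cons u vs)
  have "(\<Prod>v\<in>e. (-1) ^ count_list (u # vs) v) =
      (\<Prod>v\<in>e. (-1 :: int) ^ count_list vs v * (if u = v then -1 else 1))"
    by (rule prod.cong) auto
  also have "\<dots> = (\<Prod>v\<in>e. (-1) ^ count_list vs v) * (if u \<in> e then -1 else 1)"
    by (simp add: prod.distrib prod.delta)
  finally have "(\<Prod>v\<in>e. (-1) ^ count_list (u # vs) v) =
      (\<Prod>v\<in>e. (-1) ^ count_list vs v) * (if u \<in> e then -1 else 1 :: int)" .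
  moreover have "vertex_switch u \<gamma> e = (if u \<in> e then -1 else 1) * \<gamma> e"
    by (simp add: vertex_switch_def)
  ultimately show ?case by (simp only: fold_simps Cons.IH mult.assoc)
qed simp

lemma distinct_count_list:
  assumes "distinct xs"
  shows "count_list xs x = (if x \<in> set xs then 1 else 0)"
  using assms by (induction xs) auto

text \<open>Only the parity of the number of switchings at each vertex matters, and it is recorded
  by the sign \<open>s v\<close>. Conversely, \<open>s\<close> is realised by switching once at each
  vertex of sign -1.\<close>

lemma switching_equivalent_iff:
  "switching_equivalent E \<gamma> \<gamma>' \<longleftrightarrow>
    (\<exists>s. (\<forall>v. s v \<in> {1, -1}) \<and> (\<forall>e\<in>E. (\<Prod>v\<in>e. s v) * \<gamma> e = \<gamma>' e))"
proof
  assume "switching_equivalent E \<gamma> \<gamma>'"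
  then obtain vs where "\<forall>e\<in>E. fold vertex_switch vs \<gamma> e = \<gamma>' e"
    by (auto simp: switching_equivalent_def)
  moreover have "(-1 :: int) ^ n \<in> {1, -1}" for n
    by (cases "even n") auto
  ultimately show "\<exists>s. (\<forall>v. s v \<in> {1, -1}) \<and> (\<forall>e\<in>E. (\<Prod>v\<in>e. s v) * \<gamma> e = \<gamma>' e)"
    by (intro exI[of _ "\<lambda>v. (-1) ^ count_list vs v"]) (auto simp: fold_vertex_switch)
next
  assume "\<exists>s. (\<forall>v. s v \<in> {1, -1}) \<and> (\<forall>e\<in>E. (\<Prod>v\<in>e. s v) * \<gamma> e = \<gamma>' e)"
  then obtain s where s: "\<And>v. s v \<in> {1, -1}" "\<And>e. e \<in> E \<Longrightarrow> (\<Prod>v\<in>e. s v) * \<gamma> e = \<gamma>' e"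
    by blast
  obtain vs where vs: "set vs = {v. s v = -1}" "distinct vs"
    using finite_distinct_list[of "{v. s v = -1}"] by auto
  have "(-1) ^ count_list vs v = s v" for v
    using s(1)[of v] vs by (auto simp: distinct_count_list count_notin)
  then show "switching_equivalent E \<gamma> \<gamma>'"
    unfolding switching_equivalent_def using s(2) by (intro exI[of _ vs]) (simp add: fold_vertex_switch)
qed

section \<open>The adjacency tensor as a sum over edges\<close>

text \<open>An edge \<open>e\<close> through \<open>i\<close> is produced by exactly the
  \<open>(k - 1)!\<close> orderings of \<open>e - {i}\<close>. All of them contribute the same
  monomial, which cancels the factorial in the tensor.\<close>

lemma tensor_apply_adjacency:
  assumes "uniform_hypergraph k E"
  shows "tensor_apply k (adjacency_tensor k E \<gamma>) x $ i =
    (\<Sum>e\<in>{e\<in>E. i \<in> e}. of_int (\<gamma> e) * (\<Prod>v\<in>e-{i}. x $ v))"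
proof -
  let ?J = "{js :: 'a list. length js = k - 1}"
  let ?I = "{e\<in>E. i \<in> e}"
  let ?g = "\<lambda>js. adjacency_tensor k E \<gamma> (i # js) * (\<Prod>j\<leftarrow>js. x $ j)"
  have fin: "finite ?J"
    using finite_lists_length_eq[of "UNIV :: 'a set" "k - 1"] by simp
  have sets: "{js\<in>?J. insert i (set js) = e} = permutations_of_set (e - {i})" if "e \<in> ?I" for e
  proof -
    from that assms have e: "card e = k" "i \<in> e" by (auto simp: uniform_hypergraph_def)
    then have c: "card (e - {i}) = k - 1" by simp
    have k: "k > 0" using e by (auto simp: card_gt_0_iff)
    show ?thesis
    proof (intro equalityI subsetI)
      fix js assume "js \<in> {js\<in>?J. insert i (set js) = e}"
      then have js: "length js = k - 1" "insert i (set js) = e" by auto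
      \<comment> \<open>Together with \<open>i\<close>, a list of only \<open>k - 1\<close> entries
        must yield \<open>k\<close> elements, so it can neither repeat an entry nor contain
        \<open>i\<close>.\<close>
      then have "card (insert i (set js)) = k" using e by simp
      with js(1) k card_length[of js] have "i \<notin> set js" "card (set js) = length js"
        by (auto simp: card_insert_if split: if_splits)
      then show "js \<in> permutations_of_set (e - {i})"
        using js by (auto simp: permutations_of_set_def card_distinct)
    next
      fix js assume "js \<in> permutations_of_set (e - {i})"
      then show "js \<in> {js\<in>?J. insert i (set js) = e}"
        using e c by (auto simp: permutations_of_set_def distinct_card[symmetric])
    qed
  qed
  have "tensor_apply k (adjacency_tensor k E \<gamma>) x $ i = (\<Sum>js\<in>?J. ?g js)"
    by (simp add: tensor_apply_def)
  also have "\<dots> = (\<Sum>js\<in>{js\<in>?J. insert i (set js) \<in> ?I}. ?g js)"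
    using fin by (intro sum.mono_neutral_right) (auto simp: adjacency_tensor_def)
  \<comment> \<open>Group the index lists by the edge that they form together with
    \<open>i\<close>.\<close>
  also have "\<dots> = (\<Sum>e\<in>?I. \<Sum>js\<in>{js\<in>{js\<in>?J. insert i (set js) \<in> ?I}. insert i (set js) = e}. ?g js)"
    using fin by (intro sum.group[symmetric]) auto
  also have "\<dots> = (\<Sum>e\<in>?I. \<Sum>js\<in>permutations_of_set (e - {i}).
      of_int (\<gamma> e) / fact (k - 1) * (\<Prod>v\<in>e-{i}. x $ v))"
  proof (rule sum.cong[OF refl])
    fix e assume e: "e \<in> ?I"
    then have k: "k > 0" using assms by (auto simp: uniform_hypergraph_def card_gt_0_iff)
    have 1: "{js\<in>{js\<in>?J. insert i (set js) \<in> ?I}. insert i (set js) = e} = {js\<in>?J. insert i (set js) = e}"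
      using e by auto
    have 2: "?g js = of_int (\<gamma> e) / fact (k - 1) * (\<Prod>v\<in>e-{i}. x $ v)"
      if "js \<in> permutations_of_set (e - {i})" for js
    proof -
      have "js \<in> {js\<in>?J. insert i (set js) = e}" using that sets[OF e] by simp
      moreover have "set js = e - {i}" "distinct js"
        using that by (auto simp: permutations_of_set_def)
      ultimately show ?thesis
        using k e by (simp add: adjacency_tensor_def prod.distinct_set_conv_list[symmetric])
    qed
    show "(\<Sum>js\<in>{js\<in>{js\<in>?J. insert i (set js) \<in> ?I}. insert i (set js) = e}. ?g js) =
        (\<Sum>js\<in>permutations_of_set (e - {i}). of_int (\<gamma> e) / fact (k - 1) * (\<Prod>v\<in>e-{i}. x $ v))"
      unfolding 1 sets[OF e] by (rule sum.cong[OF refl 2])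
  qed
  also have "\<dots> = (\<Sum>e\<in>?I. of_int (\<gamma> e) * (\<Prod>v\<in>e-{i}. x $ v))"
    using assms by (intro sum.cong) (auto simp: uniform_hypergraph_def)
  finally show ?thesis .
qed

text \<open>Euler's identity for a form of degree \<open>k\<close>: each edge monomial is counted
  once for each of the \<open>k\<close> vertices of the edge. It serves to contract an eigenvalue
  equation with its eigenvector.\<close>

lemma sum_edges_containing:
  fixes x :: "'n::finite \<Rightarrow> 'a::comm_semiring_1"
  assumes "uniform_hypergraph k E"
  shows "(\<Sum>i\<in>UNIV. x i * (\<Sum>e\<in>{e\<in>E. i \<in> e}. c e * (\<Prod>v\<in>e-{i}. x v))) =
    of_nat k * (\<Sum>e\<in>E. c e * (\<Prod>v\<in>e. x v))"
proof -
  have "(\<Sum>i\<in>UNIV. x i * (\<Sum>e\<in>{e\<in>E. i \<in> e}. c e * (\<Prod>v\<in>e-{i}. x v))) =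
      (\<Sum>i\<in>UNIV. \<Sum>e\<in>{e\<in>E. i \<in> e}. c e * (\<Prod>v\<in>e. x v))"
    by (auto simp: sum_distrib_left prod.remove[of _ _ x] intro!: sum.cong)
      (simp add: ac_simps)
  also have "\<dots> = (\<Sum>e\<in>E. \<Sum>i | i \<in> e. c e * (\<Prod>v\<in>e. x v))"
    using sum.swap_restrict[of UNIV E "\<lambda>i e. c e * (\<Prod>v\<in>e. x v)" "\<lambda>i e. i \<in> e"] by simp
  also have "\<dots> = (\<Sum>e\<in>E. of_nat k * (c e * (\<Prod>v\<in>e. x v)))"
    using assms by (intro sum.cong) (auto simp: uniform_hypergraph_def)
  finally show ?thesis by (simp add: sum_distrib_left)
qed

section \<open>Maximising the edge form against the power sum\<close>

definition edge_form :: "'n::finite set set \<Rightarrow> ('n \<Rightarrow> real) \<Rightarrow> real" where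
  "edge_form E x = (\<Sum>e\<in>E. \<Prod>v\<in>e. x v)"

definition power_form :: "nat \<Rightarrow> ('n::finite \<Rightarrow> real) \<Rightarrow> real" where
  "power_form k x = (\<Sum>i\<in>UNIV. x i ^ k)"

text \<open>\<open>M\<close> is the maximum of \<open>k * F / N\<close> and \<open>z\<close> a
  nonnegative point attaining it. Clearing the denominator lets the inequality range over all
  \<open>x\<close>, including 0.\<close>

definition edge_maximizer ::
    "nat \<Rightarrow> 'n::finite set set \<Rightarrow> real \<Rightarrow> ('n \<Rightarrow> real) \<Rightarrow> bool" where
  "edge_maximizer k E M z \<longleftrightarrow> (\<exists>i. z i \<noteq> 0) \<and> (\<forall>i. z i \<ge> 0) \<and>
     k * edge_form E z = M * power_form k z \<and>
     (\<forall>x. k * edge_form E x \<le> M * power_form k x)"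

lemma edge_form_scale:
  assumes "uniform_hypergraph k E"
  shows "edge_form E (\<lambda>i. c * x i) = c ^ k * edge_form E x"
  using assms
  by (auto simp: edge_form_def sum_distrib_left prod.distrib uniform_hypergraph_def intro!: sum.cong)

lemma power_form_scale: "power_form k (\<lambda>i. c * x i) = c ^ k * power_form k x"
  by (simp add: power_form_def sum_distrib_left power_mult_distrib)

lemma power_form_abs: "even k \<Longrightarrow> power_form k (\<lambda>i. \<bar>x i\<bar>) = power_form k x"
  by (simp add: power_form_def power_even_abs)

lemma power_form_pos:
  assumes "even k" "x i \<noteq> 0"
  shows "power_form k x > 0"
  unfolding power_form_def
  by (rule sum_pos2[where i = i]) (use assms in \<open>auto simp: zero_less_power_eq zero_le_even_power\<close>)

lemma edge_form_le_abs: "edge_form E x \<le> edge_form E (\<lambda>i. \<bar>x i\<bar>)"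
  unfolding edge_form_def
  by (intro sum_mono) (simp flip: abs_prod)

lemma edge_maximizer_exists:
  fixes E :: "'n::finite set set"
  assumes "uniform_hypergraph k E" "even k" "k > 0"
  shows "\<exists>M z. edge_maximizer k E M z"
proof -
  let ?S = "{x :: real^'n. power_form k (($) x) = 1}"
  have "closed ?S"
    unfolding power_form_def by (intro closed_Collect_eq continuous_intros)
  moreover have "bounded ?S"
  proof -
    \<comment> \<open>Since \<open>k\<close> is even, each power in the sum is nonnegative and hence
      at most 1, so \<open>?S\<close> lies in the unit cube.\<close>
    have "norm x \<le> real CARD('n)" if "x \<in> ?S" for x
    proof -
      have "\<bar>x $ i\<bar> \<le> 1" for i
      proof -
        have "(x $ i) ^ k \<le> power_form k (($) x)"
          unfolding power_form_def
          by (rule member_le_sum) (use assms in \<open>auto simp: zero_le_even_power\<close>)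
        then have "\<bar>x $ i\<bar> ^ k \<le> 1" using that assms by (simp add: power_even_abs)
        then show ?thesis using assms(3) by (simp add: power_le_one_iff)
      qed
      then have "(\<Sum>i\<in>UNIV. \<bar>x $ i\<bar>) \<le> (\<Sum>i\<in>(UNIV::'n set). 1)" by (intro sum_mono) auto
      then show ?thesis using norm_le_l1_cart[of x] by simp
    qed
    then show ?thesis by (auto simp: bounded_iff)
  qed
  moreover have "?S \<noteq> {}"
  proof -
    have "power_form k (($) (axis (undefined :: 'n) 1)) = 1"
      using assms(3) by (simp add: power_form_def axis_def if_distrib[of "\<lambda>t. t ^ k"] zero_power cong: if_cong)
    then show ?thesis by blast
  qed
  moreover have "continuous_on ?S (\<lambda>x. edge_form E (($) x))"
    unfolding edge_form_def by (intro continuous_intros)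
  ultimately obtain x0 where x0: "x0 \<in> ?S" "\<And>y. y \<in> ?S \<Longrightarrow> edge_form E (($) y) \<le> edge_form E (($) x0)"
    using continuous_attains_sup[of ?S "\<lambda>x. edge_form E (($) x)"] by (auto simp: compact_eq_bounded_closed)
  define z where "z = (\<lambda>i. \<bar>x0 $ i\<bar>)"
  have Nz: "power_form k z = 1"
    using x0(1) assms by (simp add: z_def power_form_abs)
  have max: "edge_form E y \<le> edge_form E z" if "power_form k y = 1" for y
  proof -
    have "edge_form E y \<le> edge_form E (($) x0)"
      using x0(2)[of "vec_lambda y"] that by (simp add: vec_lambda_inverse)
    also have "\<dots> \<le> edge_form E z" unfolding z_def by (rule edge_form_le_abs)
    finally show ?thesis .
  qed
  have "edge_form E x \<le> edge_form E z * power_form k x" for x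
  proof (cases "\<exists>i. x i \<noteq> 0")
    case True
    then have N: "power_form k x > 0" using assms power_form_pos by blast
    \<comment> \<open>This factor rescales \<open>x\<close> to power sum 1; both forms are
      homogeneous of degree \<open>k\<close>, so the bound on the compact set carries over to
      \<open>x\<close>.\<close>
    define c where "c = root k (1 / power_form k x)"
    have c: "c ^ k = 1 / power_form k x"
      unfolding c_def using N assms by (simp add: real_root_pow_pos2)
    have "c ^ k * edge_form E x \<le> edge_form E z"
      using max[of "\<lambda>i. c * x i"] c N by (simp add: edge_form_scale[OF assms(1)] power_form_scale)
    then show ?thesis using c N by (simp add: field_simps)
  next
    case False
    then have x: "x = (\<lambda>_. 0)" by auto
    have "edge_form E x = 0"
      using edge_form_scale[OF assms(1), of 0 x] assms(3) x by (simp add: zero_power)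
    moreover have "power_form k x = 0"
      using assms(3) x by (simp add: power_form_def zero_power)
    ultimately show ?thesis by simp
  qed
  moreover have "\<exists>i. z i \<noteq> 0"
  proof (rule ccontr)
    assume "\<not> ?thesis"
    then have "power_form k z = 0" using assms(3) by (simp add: power_form_def zero_power)
    with Nz show False by simp
  qed
  moreover have "z i \<ge> 0" for i by (simp add: z_def)
  ultimately have "edge_maximizer k E (k * edge_form E z) z"
    using Nz by (auto simp: edge_maximizer_def mult.assoc intro!: mult_left_mono)
  then show ?thesis by blast
qed

text \<open>A Perron-Frobenius type argument. If \<open>z\<close> had zeros, connectedness would
  give an edge \<open>e\<close> with both zero and positive coordinates, and raising all zeros to a
  small \<open>t\<close> would increase the form by more than maximality permits.\<close>

lemma edge_maximizer_pos:
  assumes "uniform_hypergraph k E" "connected_hypergraph E" "k > 0"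
    and max: "edge_maximizer k E M z"
  shows "z i > 0"
proof (rule ccontr)
  assume "\<not> z i > 0"
  define Z where "Z = {i. z i = 0}"
  have z0: "\<And>i. z i \<ge> 0" using max by (auto simp: edge_maximizer_def)
  then have "z i = 0" using \<open>\<not> z i > 0\<close> by (meson antisym not_less)
  moreover obtain j where "z j \<noteq> 0" using max by (auto simp: edge_maximizer_def)
  ultimately obtain e where e: "e \<in> E" "e \<inter> Z \<noteq> {}" "e - Z \<noteq> {}"
    using connected_hypergraph_crossing_edge[OF assms(2), of i Z j] by (auto simp: Z_def)
  \<comment> \<open>The raised point gains at least \<open>t ^ m * c\<close> from \<open>e\<close>,
    while \<open>D * t ^ k\<close> bounds the increase of \<open>M * N\<close>. As \<open>e\<close>
    leaves \<open>Z\<close>, \<open>m < k\<close>, which keeps a spare factor \<open>t\<close> on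
    the side of the cost.\<close>
  define m where "m = card (e \<inter> Z)"
  define c where "c = (\<Prod>v\<in>e-Z. z v)"
  define D where "D = \<bar>M\<bar> * card Z"
  have "card e = k" using assms(1) e by (auto simp: uniform_hypergraph_def)
  moreover have "card (e \<inter> Z) < card e" using e by (intro psubset_card_mono) auto
  ultimately have m: "Suc m \<le> k" by (simp add: m_def)
  have c: "c > 0" unfolding c_def using z0 by (intro prod_pos) (auto simp: Z_def less_le)
  have key: "k * c \<le> D * t" if t: "0 < t" "t \<le> 1" for t
  proof -
    define x where "x = (\<lambda>v. if v \<in> Z then t else z v)"
    have xz: "z v \<le> x v" for v using t by (auto simp: x_def Z_def)
    have "(\<Prod>v\<in>e. z v) = 0" using e by (auto simp: Z_def)
    then have "edge_form E z = (\<Sum>f\<in>E-{e}. \<Prod>v\<in>f. z v)"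
      using e(1) by (simp only: edge_form_def sum.remove[OF finite e(1)] add_0)
    moreover have "edge_form E x = t ^ m * c + (\<Sum>f\<in>E-{e}. \<Prod>v\<in>f. x v)"
    proof -
      have "(\<Prod>v\<in>e. x v) = (\<Prod>v\<in>e\<inter>Z. x v) * (\<Prod>v\<in>e-Z. x v)"
        by (subst prod.Int_Diff[where B = Z]) auto
      also have "(\<Prod>v\<in>e\<inter>Z. x v) = t ^ m" by (simp add: x_def m_def)
      also have "(\<Prod>v\<in>e-Z. x v) = c" unfolding c_def by (intro prod.cong) (auto simp: x_def)
      finally show ?thesis
        by (simp only: edge_form_def sum.remove[OF finite e(1)])
    qed
    moreover have "(\<Sum>f\<in>E-{e}. \<Prod>v\<in>f. z v) \<le> (\<Sum>f\<in>E-{e}. \<Prod>v\<in>f. x v)"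
      using z0 xz by (intro sum_mono prod_mono) auto
    ultimately have F: "edge_form E z + t ^ m * c \<le> edge_form E x"
      by linarith
    have "power_form k x = (\<Sum>i\<in>UNIV. z i ^ k + (if i \<in> Z then t ^ k else 0))"
      unfolding power_form_def using assms(3) by (intro sum.cong) (auto simp: x_def Z_def zero_power)
    also have "\<dots> = power_form k z + card Z * t ^ k"
      by (simp add: power_form_def sum.distrib sum.If_cases)
    finally have N: "power_form k x = power_form k z + card Z * t ^ k" .
    have "k * (t ^ m * c) \<le> k * edge_form E x - k * edge_form E z"
      using mult_left_mono[OF F, of "real k"] by (simp add: algebra_simps)
    also have "\<dots> \<le> M * power_form k x - M * power_form k z"
      using max by (auto simp: edge_maximizer_def)
    also have "\<dots> = M * card Z * t ^ k" by (simp add: N algebra_simps)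
    also have "\<dots> \<le> D * t ^ k"
      unfolding D_def using t by (intro mult_right_mono) auto
    also have "\<dots> \<le> D * t ^ Suc m"
      using t m by (intro mult_left_mono power_decreasing) (auto simp: D_def)
    finally have "t ^ m * (k * c) \<le> t ^ m * (D * t)" by (simp add: algebra_simps)
    then show ?thesis using t by (simp add: mult_le_cancel_left)
  qed
  have kc: "k * c > 0" using c assms(3) by simp
  have D: "D \<ge> 0" by (simp add: D_def)
  \<comment> \<open>This \<open>t\<close> lies in \<open>(0, 1]\<close> even if
    \<open>D = 0\<close>, and it satisfies \<open>D * t < k * c\<close>, contradicting
    \<open>key\<close>.\<close>
  have "k * c \<le> D * (k * c / (k * c + D))"
    using kc D by (intro key) (auto simp: field_simps)
  then have "(k * c) * (k * c + D) \<le> D * (k * c)"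
    using kc D by (simp add: pos_le_divide_eq)
  then have "(k * c) * (k * c) \<le> 0" by (simp add: algebra_simps)
  with mult_pos_pos[OF kc kc] show False by linarith
qed

text \<open>The maximality inequality holds for all real vectors, so the \<open>i\<close>-th
  coordinate of \<open>z\<close> may move in both directions. The slack \<open>g\<close> along this
  line has a minimum at 0, and its vanishing derivative is the eigenvalue equation.\<close>

lemma edge_maximizer_critical:
  assumes "k > 0" and max: "edge_maximizer k E M z"
  shows "(\<Sum>e\<in>{e\<in>E. i \<in> e}. \<Prod>v\<in>e-{i}. z v) = M * z i ^ (k - 1)"
proof -
  define L where "L = (\<Sum>e\<in>{e\<in>E. i \<in> e}. \<Prod>v\<in>e-{i}. z v)"
  define x where "x = (\<lambda>t. z(i := z i + t))"
  define g where "g = (\<lambda>t. M * ((z i + t) ^ k + (\<Sum>j\<in>UNIV-{i}. z j ^ k)) - k * (edge_form E z + t * L))"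
  have N: "power_form k (x t) = (z i + t) ^ k + (\<Sum>j\<in>UNIV-{i}. z j ^ k)" for t
    by (simp add: power_form_def x_def sum.remove[of UNIV i])
  \<comment> \<open>Each edge monomial is linear in every single coordinate.\<close>
  have F: "edge_form E (x t) = edge_form E z + t * L" for t
  proof -
    have "(\<Prod>v\<in>e. x t v) = (\<Prod>v\<in>e. z v) + (if i \<in> e then t * (\<Prod>v\<in>e-{i}. z v) else 0)" for e
    proof (cases "i \<in> e")
      case True
      have "(\<Prod>v\<in>e-{i}. x t v) = (\<Prod>v\<in>e-{i}. z v)"
        by (intro prod.cong) (auto simp: x_def)
      with True show ?thesis by (simp add: prod.remove[of e i] x_def algebra_simps)
    next
      case False
      then have "(\<Prod>v\<in>e. x t v) = (\<Prod>v\<in>e. z v)"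
        by (intro prod.cong) (auto simp: x_def)
      with False show ?thesis by simp
    qed
    then show ?thesis
      by (simp add: edge_form_def L_def sum.distrib sum_distrib_left flip: sum.inter_filter)
  qed
  have g: "g t = M * power_form k (x t) - k * edge_form E (x t)" for t
    by (simp add: g_def N F)
  have "x 0 = z" by (simp add: x_def)
  then have "g 0 = 0" "g t \<ge> 0" for t
    using max by (simp_all add: g edge_maximizer_def)
  then have "\<forall>t. \<bar>0 - t\<bar> < 1 \<longrightarrow> g 0 \<le> g t" by simp
  moreover have "(g has_real_derivative M * (k * z i ^ (k - 1)) - k * L) (at 0)"
    unfolding g_def by (auto intro!: derivative_eq_intros)
  ultimately have "M * (k * z i ^ (k - 1)) - k * L = 0"
    by (intro DERIV_local_min[where d = 1]) auto
  then have "k * (M * z i ^ (k - 1)) = k * L" by (simp add: algebra_simps)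
  then show ?thesis using assms(1) by (simp add: L_def)
qed

section \<open>The maximum is the spectral radius\<close>

text \<open>The maximiser is an eigenvector for \<open>M\<close>. For any other eigenpair, the
  entrywise moduli of the eigenvector are a test vector showing that the modulus of the eigenvalue
  is at most \<open>M\<close>.\<close>

lemma tensor_spectral_radius_adjacency:
  assumes "uniform_hypergraph k E" "even k" "k > 0" and max: "edge_maximizer k E M z"
  shows "tensor_spectral_radius k (adjacency_tensor k E (\<lambda>e. 1)) = M"
  unfolding tensor_spectral_radius_def
proof (rule Greatest_equality)
  have z0: "\<And>i. z i \<ge> 0" and "\<exists>i. z i \<noteq> 0" using max by (auto simp: edge_maximizer_def)
  then have Nz: "power_form k z > 0" using assms power_form_pos by blast
  \<comment> \<open>Nonnegativity of \<open>M\<close> is what makes \<open>M\<close> the modulus of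
    the eigenvalue \<open>M\<close>.\<close>
  have "edge_form E z \<ge> 0"
    unfolding edge_form_def using z0 by (intro sum_nonneg prod_nonneg) auto
  then have "M * power_form k z \<ge> 0" using max by (metis edge_maximizer_def mult_nonneg_nonneg of_nat_0_le_iff)
  then have M: "M \<ge> 0" using Nz by (simp add: zero_le_mult_iff)
  define x :: "complex ^ 'a" where "x = (\<chi> i. of_real (z i))"
  have "tensor_apply k (adjacency_tensor k E (\<lambda>e. 1)) x $ i = of_real M * (x $ i) ^ (k - 1)" for i
    using arg_cong[OF edge_maximizer_critical[OF assms(3) max, of i], of complex_of_real]
    by (simp add: tensor_apply_adjacency[OF assms(1)] x_def)
  moreover have "x \<noteq> 0" using \<open>\<exists>i. z i \<noteq> 0\<close> by (auto simp: x_def vec_eq_iff)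
  ultimately have "is_eigenpair k (adjacency_tensor k E (\<lambda>e. 1)) (of_real M) x"
    by (simp add: is_eigenpair_def vec_eq_iff)
  then show "\<exists>l. tensor_eigenvalue k (adjacency_tensor k E (\<lambda>e. 1)) l \<and> M = cmod l"
    using M by (intro exI[of _ "of_real M"]) (auto simp: tensor_eigenvalue_def)
next
  fix r assume "\<exists>l. tensor_eigenvalue k (adjacency_tensor k E (\<lambda>e. 1)) l \<and> r = cmod l"
  then obtain l x where r: "r = cmod l" and x: "x \<noteq> 0"
    and eq: "tensor_apply k (adjacency_tensor k E (\<lambda>e. 1)) x = (\<chi> i. l * (x $ i) ^ (k - 1))"
    by (auto simp: tensor_eigenvalue_def is_eigenpair_def)
  define y where "y = (\<lambda>i. cmod (x $ i))"
  obtain i where "y i \<noteq> 0" using x by (auto simp: y_def vec_eq_iff)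
  then have Ny: "power_form k y > 0" using assms power_form_pos by blast
  have "r * y i ^ k \<le> y i * (\<Sum>e\<in>{e\<in>E. i \<in> e}. 1 * (\<Prod>v\<in>e-{i}. y v))" for i
  proof -
    have "r * y i ^ (k - 1) = cmod (l * (x $ i) ^ (k - 1))"
      by (simp add: r y_def norm_mult norm_power)
    also have "\<dots> = cmod (\<Sum>e\<in>{e\<in>E. i \<in> e}. \<Prod>v\<in>e-{i}. x $ v)"
      using eq tensor_apply_adjacency[OF assms(1), of "\<lambda>_. 1" x i] by simp
    also have "\<dots> \<le> (\<Sum>e\<in>{e\<in>E. i \<in> e}. \<Prod>v\<in>e-{i}. y v)"
      by (rule order_trans[OF norm_sum]) (simp add: y_def prod_norm)
    finally have "y i * (r * y i ^ (k - 1)) \<le> y i * (\<Sum>e\<in>{e\<in>E. i \<in> e}. \<Prod>v\<in>e-{i}. y v)"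
      by (rule mult_left_mono) (simp add: y_def)
    moreover have "y i ^ k = y i * y i ^ (k - 1)" using assms(3) by (simp add: power_eq_if)
    ultimately show ?thesis by (simp add: algebra_simps)
  qed
  then have "(\<Sum>i\<in>UNIV. r * y i ^ k) \<le>
      (\<Sum>i\<in>UNIV. y i * (\<Sum>e\<in>{e\<in>E. i \<in> e}. 1 * (\<Prod>v\<in>e-{i}. y v)))"
    by (rule sum_mono)
  then have "r * power_form k y \<le> k * edge_form E y"
    unfolding sum_edges_containing[OF assms(1)]
    by (simp add: power_form_def edge_form_def sum_distrib_left)
  also have "\<dots> \<le> M * power_form k y" using max by (auto simp: edge_maximizer_def)
  finally show "r \<le> M" using Ny by simp
qed

section \<open>Vertex signs and the eigenvalue \<open>-M\<close>\<close>

lemma H_eigenvalue_neg_of_signs: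
  assumes "uniform_hypergraph k E" "even k" "k > 0" and max: "edge_maximizer k E M z"
    and s: "\<And>v. s v \<in> {1, -1 :: int}" and prod_s: "\<And>e. e \<in> E \<Longrightarrow> (\<Prod>v\<in>e. s v) * \<gamma> e = -1"
  shows "H_eigenvalue k (adjacency_tensor k E \<gamma>) (complex_of_real (- M))"
proof -
  define x :: "complex ^ 'a" where "x = (\<chi> i. of_real (of_int (s i) * z i))"
  have "tensor_apply k (adjacency_tensor k E \<gamma>) x $ i = of_real (- M) * (x $ i) ^ (k - 1)" for i
  proof -
    have "of_int (\<gamma> e) * (\<Prod>v\<in>e-{i}. x $ v) = of_real (- of_int (s i) * (\<Prod>v\<in>e-{i}. z v))"
      if "e \<in> {e\<in>E. i \<in> e}" for e
    proof -
      have "(\<Prod>v\<in>e. s v) = s i * (\<Prod>v\<in>e-{i}. s v)" using that by (simp add: prod.remove)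
      \<comment> \<open>Since \<open>s i\<close> is its own inverse, splitting off the factor at
        \<open>i\<close> leaves the sign \<open>- s i\<close>, the same for every edge through
        \<open>i\<close>.\<close>
      then have "s i * ((\<Prod>v\<in>e-{i}. s v) * \<gamma> e) = -1" using prod_s[of e] that by (simp add: ac_simps)
      then have "\<gamma> e * (\<Prod>v\<in>e-{i}. s v) = - s i" using s[of i] by (auto simp: ac_simps)
      then have "complex_of_int (\<gamma> e) * (\<Prod>v\<in>e-{i}. of_int (s v)) = - of_int (s i)"
        by (metis of_int_minus of_int_mult of_int_prod)
      then show ?thesis by (simp add: x_def prod.distrib flip: mult.assoc)
    qed
    then have "tensor_apply k (adjacency_tensor k E \<gamma>) x $ i =
        of_real (- of_int (s i) * (\<Sum>e\<in>{e\<in>E. i \<in> e}. \<Prod>v\<in>e-{i}. z v))"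
      by (simp add: tensor_apply_adjacency[OF assms(1)] sum_distrib_left flip: sum_negf)
    also have "\<dots> = of_real (- M * (of_int (s i) * z i ^ (k - 1)))"
      by (subst edge_maximizer_critical[OF assms(3) max]) simp
    \<comment> \<open>Here \<open>k - 1\<close> is odd, so the sign survives the power.\<close>
    also have "of_int (s i) * z i ^ (k - 1) = (of_int (s i) * z i) ^ (k - 1)"
      using s[of i] assms(2,3) by (auto simp: power_mult_distrib)
    finally show ?thesis by (simp add: x_def)
  qed
  moreover have "x \<noteq> 0"
  proof -
    obtain i where "z i \<noteq> 0" using max by (auto simp: edge_maximizer_def)
    then have "x $ i \<noteq> 0" using s[of i] by (auto simp: x_def)
    then show ?thesis by auto
  qed
  ultimately show ?thesis
    by (auto simp: H_eigenvalue_def is_eigenpair_def vec_eq_iff x_def intro!: exI[of _ x])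
qed

text \<open>The equality case of the maximum: the absolute values of a real eigenvector for
  \<open>-M\<close> form a maximiser, hence are positive, and its signs are the required
  \<open>s\<close>.\<close>

lemma signs_of_H_eigenvalue_neg:
  assumes "uniform_hypergraph k E" "connected_hypergraph E" "even k" "k > 0"
    and max: "edge_maximizer k E M z" and \<gamma>: "\<And>e. e \<in> E \<Longrightarrow> \<gamma> e \<in> {1, -1}"
    and "H_eigenvalue k (adjacency_tensor k E \<gamma>) (complex_of_real (- M))"
  shows "\<exists>s. (\<forall>v. s v \<in> {1, -1 :: int}) \<and> (\<forall>e\<in>E. (\<Prod>v\<in>e. s v) * \<gamma> e = -1)"
proof -
  obtain x where x: "\<And>i. x $ i \<in> \<real>" "x \<noteq> 0"
    and eq: "tensor_apply k (adjacency_tensor k E \<gamma>) x = (\<chi> i. of_real (- M) * (x $ i) ^ (k - 1))"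
    using assms(7) by (auto simp: H_eigenvalue_def is_eigenpair_def)
  define r where "r = (\<lambda>i. Re (x $ i))"
  define y where "y = (\<lambda>i. \<bar>r i\<bar>)"
  have xr: "x $ i = of_real (r i)" for i using x(1)[of i] by (simp add: r_def)
  obtain j where "r j \<noteq> 0" using x(2) xr by (auto simp: vec_eq_iff)
  have "(\<Sum>e\<in>{e\<in>E. i \<in> e}. of_int (\<gamma> e) * (\<Prod>v\<in>e-{i}. r v)) = - M * r i ^ (k - 1)" for i
  proof -
    have "complex_of_real (\<Sum>e\<in>{e\<in>E. i \<in> e}. of_int (\<gamma> e) * (\<Prod>v\<in>e-{i}. r v)) =
        of_real (- M * r i ^ (k - 1))"
      using eq tensor_apply_adjacency[OF assms(1), of \<gamma> x i] by (simp add: xr)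
    then show ?thesis by (simp only: of_real_eq_iff)
  qed
  then have "r i * (\<Sum>e\<in>{e\<in>E. i \<in> e}. of_int (\<gamma> e) * (\<Prod>v\<in>e-{i}. r v)) = - M * r i ^ k" for i
    using assms(4) by (simp add: power_eq_if)
  then have "real k * (\<Sum>e\<in>E. of_int (\<gamma> e) * (\<Prod>v\<in>e. r v)) = - M * power_form k r"
    unfolding sum_edges_containing[OF assms(1), symmetric] by (simp add: power_form_def sum_distrib_left sum_negf)
  moreover have Ny: "power_form k y = power_form k r"
    unfolding y_def by (rule power_form_abs[OF assms(3)])
  moreover have "k * edge_form E y \<le> M * power_form k y"
    using max by (auto simp: edge_maximizer_def)
  \<comment> \<open>The contracted eigenvalue equation is added to the maximality bound at
    \<open>y\<close>; the two terms with \<open>M\<close> cancel.\<close>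
  ultimately have "real k * (\<Sum>e\<in>E. (\<Prod>v\<in>e. y v) + of_int (\<gamma> e) * (\<Prod>v\<in>e. r v)) \<le> 0"
    and kr: "real k * (\<Sum>e\<in>E. of_int (\<gamma> e) * (\<Prod>v\<in>e. r v)) = - M * power_form k y"
    by (simp_all add: sum.distrib edge_form_def distrib_left)
  then have le0: "(\<Sum>e\<in>E. (\<Prod>v\<in>e. y v) + of_int (\<gamma> e) * (\<Prod>v\<in>e. r v)) \<le> 0"
    using assms(4) by (simp add: mult_le_0_iff)
  have ge0: "(\<Prod>v\<in>e. y v) + of_int (\<gamma> e) * (\<Prod>v\<in>e. r v) \<ge> 0" if "e \<in> E" for e
    using \<gamma>[OF that] by (auto simp: y_def simp flip: abs_prod)
  \<comment> \<open>Each summand is nonnegative because its second term has absolute value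
    \<open>(\<Prod>v\<in>e. y v)\<close>. So the sum vanishes, and with it every summand.\<close>
  have sum0: "(\<Sum>e\<in>E. (\<Prod>v\<in>e. y v) + of_int (\<gamma> e) * (\<Prod>v\<in>e. r v)) = 0"
    using le0 ge0 by (intro antisym sum_nonneg) auto
  then have edge0: "(\<Prod>v\<in>e. y v) + of_int (\<gamma> e) * (\<Prod>v\<in>e. r v) = 0" if "e \<in> E" for e
    using ge0 that by (subst (asm) sum_nonneg_eq_0_iff) auto
  have "edge_form E y = - (\<Sum>e\<in>E. of_int (\<gamma> e) * (\<Prod>v\<in>e. r v))"
    using sum0 by (simp add: edge_form_def sum.distrib)
  then have "k * edge_form E y = M * power_form k y" using kr by simp
  then have "edge_maximizer k E M y"
    using max \<open>r j \<noteq> 0\<close> by (auto simp: edge_maximizer_def y_def)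
  then have "y v > 0" for v using assms edge_maximizer_pos by blast
  then have r0: "r v \<noteq> 0" for v by (auto simp: y_def)
  define s where "s = (\<lambda>v. if r v > 0 then 1 else -1 :: int)"
  have "(\<Prod>v\<in>e. s v) * \<gamma> e = -1" if "e \<in> E" for e
  proof -
    have "(\<Prod>v\<in>e. r v) = (\<Prod>v\<in>e. of_int (s v) * y v)"
      by (intro prod.cong) (auto simp: s_def y_def)
    also have "\<dots> = of_int (\<Prod>v\<in>e. s v) * (\<Prod>v\<in>e. y v)" by (simp add: prod.distrib)
    finally have "(\<Prod>v\<in>e. y v) * (1 + of_int ((\<Prod>v\<in>e. s v) * \<gamma> e)) = 0"
      using edge0[OF that] by (simp add: algebra_simps)
    moreover have "(\<Prod>v\<in>e. y v) \<noteq> 0" using r0 by (simp add: y_def)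
    ultimately have "1 + real_of_int ((\<Prod>v\<in>e. s v) * \<gamma> e) = 0" by simp
    then show ?thesis by linarith
  qed
  then show ?thesis by (intro exI[of _ s]) (auto simp: s_def)
qed

section \<open>The edgeless case and the equivalence\<close>

text \<open>Without edges uniformity leaves \<open>k = 0\<close> possible, so this case is handled
  directly: the tensor is zero and 0 is its only eigenvalue.\<close>

lemma H_eigenvalue_edgeless:
  "H_eigenvalue k (adjacency_tensor k ({} :: 'n::finite set set) \<gamma>)
    (complex_of_real (- tensor_spectral_radius k (adjacency_tensor k ({} :: 'n set set) (\<lambda>e. 1))))"
proof -
  have apply0: "tensor_apply k (adjacency_tensor k {} \<gamma>) x = 0" for \<gamma> and x :: "complex ^ 'n"
    by (simp add: tensor_apply_def adjacency_tensor_def vec_eq_iff)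
  have pair: "is_eigenpair k (adjacency_tensor k {} \<gamma>) 0 (\<chi> i :: 'n. 1)" for \<gamma>
    by (simp add: is_eigenpair_def apply0 vec_eq_iff)
  have "tensor_spectral_radius k (adjacency_tensor k ({} :: 'n set set) (\<lambda>e. 1)) = 0"
    unfolding tensor_spectral_radius_def
  proof (rule Greatest_equality)
    show "\<exists>l. tensor_eigenvalue k (adjacency_tensor k ({} :: 'n set set) (\<lambda>e. 1)) l \<and> 0 = cmod l"
      using pair by (force simp: tensor_eigenvalue_def)
  next
    fix r
    assume "\<exists>l. tensor_eigenvalue k (adjacency_tensor k ({} :: 'n set set) (\<lambda>e. 1)) l \<and> r = cmod l"
    then show "r \<le> 0"
      by (auto simp: tensor_eigenvalue_def is_eigenpair_def apply0 vec_eq_iff)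
  qed
  moreover have "H_eigenvalue k (adjacency_tensor k ({} :: 'n set set) \<gamma>) 0"
    unfolding H_eigenvalue_def using pair by (intro exI[of _ "\<chi> i. 1"]) auto
  ultimately show ?thesis by simp
qed

theorem theorem4p5:
  fixes k :: nat
    and E :: "'n::finite set set"
    and \<sigma> :: "'n set \<Rightarrow> 'n \<Rightarrow> int"
  assumes "uniform_hypergraph k E"
    and "connected_hypergraph E"
    and "even k"
    and "is_orientation E \<sigma>"
  shows "switching_equivalent E (induced_sign \<sigma>) (induced_sign positive_orientation) \<longleftrightarrow>
    H_eigenvalue k (adjacency_tensor k E (induced_sign \<sigma>))
      (complex_of_real (- tensor_spectral_radius k (adjacency_tensor k E (\<lambda>e. 1))))"
proof (cases "E = {}")
  case True
  then show ?thesis using H_eigenvalue_edgeless by (simp add: switching_equivalent_def)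
next
  case False
  then obtain e where "e \<in> E" "e \<noteq> {}"
    using connected_hypergraph_edge_nonempty[OF assms(2)] by blast
  then have k: "k > 0" using assms(1) by (auto simp: uniform_hypergraph_def card_gt_0_iff)
  obtain M z where max: "edge_maximizer k E M z"
    using edge_maximizer_exists[OF assms(1,3) k] by blast
  \<comment> \<open>As \<open>k - 1\<close> is odd, the all-positive orientation induces the sign -1
    on every edge, which is why -1 is the target of the switching.\<close>
  have pos: "induced_sign positive_orientation e = -1" if "e \<in> E" for e
    using that assms(1,3) k
    by (simp add: induced_sign_def positive_orientation_def uniform_hypergraph_def)
  have sign: "induced_sign \<sigma> e \<in> {1, -1}" if "e \<in> E" for e
  proof -
    have "\<bar>\<Prod>v\<in>e. \<sigma> e v\<bar> = 1"
      unfolding abs_prod using that assms(4) by (intro prod.neutral) (fastforce simp: is_orientation_def)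
    then have "\<bar>induced_sign \<sigma> e\<bar> = 1" by (simp add: induced_sign_def abs_mult power_abs)
    then show ?thesis by auto
  qed
  have "switching_equivalent E (induced_sign \<sigma>) (induced_sign positive_orientation) \<longleftrightarrow>
      (\<exists>s. (\<forall>v. s v \<in> {1, -1}) \<and> (\<forall>e\<in>E. (\<Prod>v\<in>e. s v) * induced_sign \<sigma> e = -1))"
    by (simp add: switching_equivalent_iff pos)
  also have "\<dots> \<longleftrightarrow> H_eigenvalue k (adjacency_tensor k E (induced_sign \<sigma>)) (complex_of_real (- M))"
  proof
    assume "\<exists>s. (\<forall>v. s v \<in> {1, -1}) \<and> (\<forall>e\<in>E. (\<Prod>v\<in>e. s v) * induced_sign \<sigma> e = -1)"
    then obtain s where "\<And>v. s v \<in> {1, -1}" "\<And>e. e \<in> E \<Longrightarrow> (\<Prod>v\<in>e. s v) * induced_sign \<sigma> e = -1"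
      by blast
    then show "H_eigenvalue k (adjacency_tensor k E (induced_sign \<sigma>)) (complex_of_real (- M))"
      by (rule H_eigenvalue_neg_of_signs[OF assms(1,3) k max])
  qed (rule signs_of_H_eigenvalue_neg[OF assms(1-3) k max sign])
  finally show ?thesis
    using tensor_spectral_radius_adjacency[OF assms(1,3) k max] by simp
qed

end
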